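(* Let $X$ be an infinite set. If $\mathcal{C}$ is a symmetric precomplete clone on $X$, then $\mathcal{C}$ contains all permutations of $X$.
   Context: For $n\ge 1$, $\mathcal{O}^{(n)}$ is the set of all $n$-ary operations $X^n\to X$, and $\mathcal{O}=\bigcup_{n\ge 1}\mathcal{O}^{(n)}$. A clone on $X$ is a subset of $\mathcal{O}$ which contains all projections $\pi^n_k(x_1,\ldots,x_n)=x_k$ ($1\le k\le n$) and is closed under composition of functions. The clones on $X$, ordered by inclusion, form a complete lattice with greatest element $\mathcal{O}$. A clone is precomplete iff it is a dual atom of this lattice, i.e. $\mathcal{C}\ne\mathcal{O}$ and no clone lies strictly between $\mathcal{C}$ and $\mathcal{O}$. Let $\mathcal{S}\subseteq\mathcal{O}^{(1)}$ be the set of all permutations of $X$. A clone $\mathcal{C}$ is symmetric iff it is closed under conjugation, that is, $\mathcal{C}=\{\gamma^{-1}(f(\gamma(x_1),\ldots,\gamma(x_n))) : f\in\mathcal{C},\ \gamma\in\mathcal{S}\}$ ($n$ being the arity of $f$). *)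

theory Defs
  imports Main "HOL-Library.FuncSet"
begin

text \<open>
  The elements of \<open>X\<^sup>n\<close> are the lists of length \<open>n\<close> over \<open>X\<close>. An operation is a pair
  \<open>(n, f)\<close> of its arity and a function that is \<open>undefined\<close> outside \<open>X\<^sup>n\<close>, so that equality
  of pairs is equality of operations on \<open>X\<close>. The arity has to be recorded: if
  \<open>undefined \<in> X\<close>, the constant operations with this value and different arities
  are the same HOL function.
\<close>

type_synonym 'a operation = "nat \<times> ('a list \<Rightarrow> 'a)"

definition tuples :: "'a set \<Rightarrow> nat \<Rightarrow> 'a list set" where
  "tuples X n = {xs. set xs \<subseteq> X \<and> length xs = n}"

definition ops_of_arity :: "'a set \<Rightarrow> nat \<Rightarrow> 'a operation set" where
  "ops_of_arity X n = {n} \<times> (tuples X n \<rightarrow>\<^sub>E X)"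

definition ops :: "'a set \<Rightarrow> 'a operation set" where
  "ops X = (\<Union>n\<in>{1..}. ops_of_arity X n)"

definition projection :: "'a set \<Rightarrow> nat \<Rightarrow> nat \<Rightarrow> 'a operation" where
  "projection X n k = (n, \<lambda>xs\<in>tuples X n. xs ! (k - 1))"

text \<open>
  \<open>compose_ops X m f [g\<^sub>1, \<dots>, g\<^sub>n]\<close> is the \<open>m\<close>-ary operation
  \<open>xs \<mapsto> f (g\<^sub>1 xs, \<dots>, g\<^sub>n xs)\<close>, for \<open>n\<close>-ary \<open>f\<close> and \<open>m\<close>-ary \<open>g\<^sub>i\<close>.
\<close>

definition compose_ops ::
    "'a set \<Rightarrow> nat \<Rightarrow> ('a list \<Rightarrow> 'a) \<Rightarrow> ('a list \<Rightarrow> 'a) list \<Rightarrow> 'a operation" where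
  "compose_ops X m f gs = (m, \<lambda>xs\<in>tuples X m. f (map (\<lambda>g. g xs) gs))"

definition clone :: "'a set \<Rightarrow> 'a operation set \<Rightarrow> bool" where
  "clone X C \<longleftrightarrow>
     C \<subseteq> ops X \<and>
     (\<forall>n k. 1 \<le> k \<and> k \<le> n \<longrightarrow> projection X n k \<in> C) \<and>
     (\<forall>n m f gs. (n, f) \<in> C \<and> length gs = n \<and> (\<forall>g\<in>set gs. (m, g) \<in> C)
        \<longrightarrow> compose_ops X m f gs \<in> C)"

definition precomplete :: "'a set \<Rightarrow> 'a operation set \<Rightarrow> bool" where
  "precomplete X C \<longleftrightarrow>
     clone X C \<and> C \<noteq> ops X \<and> \<not> (\<exists>D. clone X D \<and> C \<subset> D \<and> D \<subset> ops X)"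

definition permutation_ops :: "'a set \<Rightarrow> 'a operation set" where
  "permutation_ops X = {(1, \<lambda>xs\<in>tuples X 1. \<gamma> (hd xs)) | \<gamma>. bij_betw \<gamma> X X}"

definition conjugate_op :: "'a set \<Rightarrow> ('a \<Rightarrow> 'a) \<Rightarrow> 'a operation \<Rightarrow> 'a operation" where
  "conjugate_op X \<gamma> = (\<lambda>(n, f). (n, \<lambda>xs\<in>tuples X n. inv_into X \<gamma> (f (map \<gamma> xs))))"

definition symmetric :: "'a set \<Rightarrow> 'a operation set \<Rightarrow> bool" where
  "symmetric X C \<longleftrightarrow> C = {conjugate_op X \<gamma> f | f \<gamma>. f \<in> C \<and> bij_betw \<gamma> X X}"

end

theory Submission
  imports Defs "HOL-Library.Equipollence"
begin

text \<open>
  Suppose that \<open>C\<close> does not contain all permutations. For a subset \<open>Y\<close> of \<open>X\<close> with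
  \<open>|Y| = |X - Y| = |X|\<close>, let \<open>H\<close> be the group of all permutations fixing \<open>Y\<close> pointwise.
  Such groups are conjugate and generate the symmetric group, so \<open>H\<close> is not contained in \<open>C\<close>
  and hence \<open>C \<union> H\<close> generates all operations. As \<open>C\<close> is closed under conjugation, every
  operation is obtained by substituting elements of \<open>H\<close> applied to variables into an operation
  of \<open>C\<close>; in particular it agrees on \<open>Y\<close> with an operation of \<open>C\<close>.

  Now let \<open>u \<in> C\<close> be constant on \<open>Y\<^sub>1\<close> and the identity on \<open>Y\<^sub>2\<close>, where \<open>X\<close> is partitioned
  into \<open>Y\<^sub>1, Y\<^sub>2, Y\<^sub>3\<close> of full size. If \<open>\<gamma>\<close> moves only points of \<open>Y\<^sub>1\<close>, then
  \<open>\<gamma> \<circ> u = \<gamma> \<circ> u \<circ> \<gamma>\<inverse> \<in> C\<close>. Since these \<open>\<gamma>\<close> generate all operations over \<open>C\<close>, we get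
  \<open>b \<circ> u \<in> C\<close> for all unary \<open>b\<close>, and so \<open>C\<close> contains a retraction \<open>v\<close> of \<open>X\<close> onto \<open>Y\<^sub>2\<close>.
  For a bijection \<open>e\<close> from \<open>X\<close> onto \<open>Y\<^sub>2\<close>, interpolation followed by \<open>v\<close> yields
  \<open>w\<^sub>1, w\<^sub>2, w\<^sub>3 \<in> C\<close> with values in \<open>Y\<^sub>2\<close> such that \<open>w\<^sub>i = e\<close> off \<open>Y\<^sub>i\<close>. The majority of
  the three values at \<open>x\<close> is \<open>e x\<close>, so interpolation on \<open>Y\<^sub>2\<close> puts every unary
  operation into \<open>C\<close>, a contradiction.
\<close>

section \<open>Cardinalities of subsets and moieties\<close>

lemma eqpoll_between:
  assumes "A \<subseteq> B" "B \<subseteq> X" "A \<approx> X"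
  shows "B \<approx> X"
  using assms by (meson eqpoll_imp_lepoll eqpoll_sym lepoll_antisym lepoll_trans1 subset_imp_lepoll)

text \<open>An infinite cardinal equals its double; \<open>A\<close> and \<open>B\<close> are the
  images of the two copies of \<open>Z\<close>.\<close>

lemma infinite_split:
  includes cardinal_syntax
  assumes "infinite Z"
  obtains A B where "A \<union> B = Z" "A \<inter> B = {}" "A \<approx> Z" "B \<approx> Z"
proof -
  have "|Z <+> Z| =o |Z|"
    using card_of_Plus_infinite1[OF assms card_of_mono1[OF subset_refl]] .
  then obtain f where f: "bij_betw f (Z <+> Z) Z"
    using card_of_ordIso by blast
  then have inj: "inj_on f (Z <+> Z)" and im: "f ` (Z <+> Z) = Z"
    by (auto simp: bij_betw_def)
  have eq: "f ` Inl ` Z \<approx> Z" "f ` Inr ` Z \<approx> Z"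
    using inj by (auto simp: image_image intro!: inj_on_image_eqpoll_self inj_onI dest!: inj_onD)
  show thesis
  proof (rule that[OF _ _ eq])
    show "f ` Inl ` Z \<union> f ` Inr ` Z = Z"
      using im by (simp add: Plus_def image_Un)
    show "f ` Inl ` Z \<inter> f ` Inr ` Z = {}"
      using inj by (auto dest!: inj_onD)
  qed
qed

lemma infinite_Un_eqpoll:
  includes cardinal_syntax
  assumes "infinite X" "A \<union> B \<approx> X" "\<not> A \<approx> X"
  shows "B \<approx> X"
proof (rule ccontr)
  assume B: "\<not> B \<approx> X"
  have "A \<lesssim> X" "B \<lesssim> X"
    using assms(2) by (meson Un_upper1 Un_upper2 lepoll_trans2 subset_imp_lepoll)+
  then have "|A| <o |X|" "|B| <o |X|"
    using B assms(3)
    by (simp_all add: lepoll_def card_of_ordLeq eqpoll_iff_card_of_ordIso ordLeq_iff_ordLess_or_ordIso)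
  then have "|A \<union> B| <o |X|"
    using assms(1) card_of_Un_ordLess_infinite by blast
  then show False
    using assms(2) by (simp add: eqpoll_iff_card_of_ordIso not_ordLess_ordIso)
qed

definition moiety :: "'a set \<Rightarrow> 'a set \<Rightarrow> bool" where
  "moiety X Y \<longleftrightarrow> Y \<subseteq> X \<and> Y \<approx> X \<and> X - Y \<approx> X"

lemma bij_betw_glue:
  assumes "bij_betw f A B" "bij_betw g (X - A) (X - B)" "A \<subseteq> X" "B \<subseteq> X"
  obtains d where "bij_betw d X X" "\<And>x. x \<in> A \<Longrightarrow> d x = f x" "\<And>x. x \<in> X - A \<Longrightarrow> d x = g x"
proof -
  let ?d = "\<lambda>x. if x \<in> A then f x else g x"
  have "bij_betw ?d A B"
    using assms(1) by (rule bij_betw_cong[THEN iffD1, rotated]) simp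
  moreover have "bij_betw ?d (X - A) (X - B)"
    using assms(2) by (rule bij_betw_cong[THEN iffD1, rotated]) simp
  ultimately have "bij_betw ?d (A \<union> (X - A)) (B \<union> (X - B))"
    by (rule bij_betw_combine) auto
  moreover have "A \<union> (X - A) = X" "B \<union> (X - B) = X"
    using assms(3,4) by auto
  ultimately show thesis
    using that[of ?d] by auto
qed

text \<open>Moieties form one orbit of the symmetric group, so their pointwise stabilizers are
  conjugate.\<close>

lemma moiety_bij:
  assumes "moiety X A" "moiety X B"
  obtains d where "bij_betw d X X" "d ` A = B"
proof -
  have "A \<approx> B" "X - A \<approx> X - B"
    using assms eqpoll_trans eqpoll_sym unfolding moiety_def by blast+
  then obtain f g where fg: "bij_betw f A B" "bij_betw g (X - A) (X - B)"
    unfolding eqpoll_def by blast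
  then obtain d where d: "bij_betw d X X" "\<And>x. x \<in> A \<Longrightarrow> d x = f x"
    using bij_betw_glue[OF fg] assms unfolding moiety_def by metis
  have "d ` A = f ` A"
    using d(2) by (simp cong: image_cong)
  then show thesis
    using that[OF d(1)] fg(1) by (simp add: bij_betw_def)
qed

text \<open>\<open>Z\<close> omits one half of \<open>X - Y\<close>; the other half gives it full
  size even when \<open>Y\<close> is small.\<close>

lemma colarge_subset_moiety:
  assumes "infinite X" "Y \<subseteq> X" "X - Y \<approx> X"
  obtains Z where "moiety X Z" "Y \<subseteq> Z"
proof -
  have "infinite (X - Y)"
    using assms eqpoll_finite_iff by blast
  then obtain A B where AB: "A \<union> B = X - Y" "A \<inter> B = {}" "A \<approx> X - Y" "B \<approx> X - Y"
    using infinite_split by blast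
  then have eq: "A \<approx> X" "B \<approx> X"
    using assms(3) eqpoll_trans by blast+
  have "X - A \<approx> X"
    by (rule eqpoll_between[OF _ _ eq(2)]) (use AB in auto)
  moreover have "X - (X - A) = A"
    using AB by auto
  ultimately have "moiety X (X - A)"
    using eq by (simp add: moiety_def)
  then show thesis
    using that[of "X - A"] AB assms(2) by blast
qed

section \<open>Factoring permutations through stabilizers of moieties\<close>

lemma large_displaced_set:
  assumes "infinite X" "bij_betw s X X"
  obtains Z where "Z \<subseteq> X" "Z \<approx> X" "X - (Z \<union> s ` Z) \<approx> X"
proof -
  obtain P Q where PQ: "P \<union> Q = X" "P \<inter> Q = {}" "P \<approx> X" "Q \<approx> X"
    using infinite_split[OF assms(1)] by blast
  show thesis
  proof (cases "Q - s ` P \<approx> X")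
    case True
    have "X - (P \<union> s ` P) \<approx> X"
      by (rule eqpoll_between[OF _ _ True]) (use PQ in auto)
    then show thesis
      using that[of P] PQ by auto
  next
    case False
    have "(Q - s ` P) \<union> (Q \<inter> s ` P) = Q"
      by auto
    \<comment> \<open>Since \<open>Q\<close> has full size and its part outside the image of
      \<open>P\<close> does not, the rest has. One half \<open>R\<close> of it will be the image of
      \<open>Z\<close>; the other half \<open>S\<close> stays free.\<close>
    then have large: "Q \<inter> s ` P \<approx> X"
      using infinite_Un_eqpoll[OF assms(1) _ False] PQ(4) by metis
    then obtain R S where RS: "R \<union> S = Q \<inter> s ` P" "R \<inter> S = {}" 
        "R \<approx> Q \<inter> s ` P" "S \<approx> Q \<inter> s ` P"
      using infinite_split assms(1) eqpoll_finite_iff by metis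
    then have eq: "R \<approx> X" "S \<approx> X"
      using large eqpoll_trans by blast+
    obtain Z where Z: "Z \<subseteq> P" "s ` Z = R"
      using RS(1) by (metis subset_imageE le_inf_iff sup_ge1)
    have "inj_on s Z"
      using assms(2) Z PQ unfolding bij_betw_def by (meson Un_upper1 inj_on_subset subset_trans)
    then have "Z \<approx> R"
      using Z(2) inj_on_image_eqpoll_self eqpoll_sym by blast
    moreover have "X - (Z \<union> s ` Z) \<approx> X"
      by (rule eqpoll_between[OF _ _ eq(2)]) (use Z RS PQ in auto)
    ultimately show thesis
      using that[of Z] Z PQ eq eqpoll_trans by blast
  qed
qed

definition pointwise_stabilizer :: "'a set \<Rightarrow> 'a set \<Rightarrow> ('a \<Rightarrow> 'a) set" where
  "pointwise_stabilizer X Y = {g. bij_betw g X X \<and> (\<forall>x\<in>Y. g x = x)}"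

text \<open>The permutation \<open>t\<close> undoes \<open>s\<close> on the image of
  \<open>Z\<close> and fixes \<open>A\<close>, one half of the free room, so \<open>s\<close> is the
  product of the inverse of \<open>t\<close> and \<open>t \<circ> s\<close>, each fixing a moiety
  pointwise.\<close>

lemma permutation_factorization:
  assumes "infinite X" "bij_betw s X X"
  obtains Y t Z where "moiety X Y" "moiety X Z" "t \<in> pointwise_stabilizer X Y"
    "t \<circ> s \<in> pointwise_stabilizer X Z"
proof -
  obtain Z where Z: "Z \<subseteq> X" "Z \<approx> X" "X - (Z \<union> s ` Z) \<approx> X"
    using large_displaced_set[OF assms] by blast
  let ?R = "X - (Z \<union> s ` Z)"
  have sZ: "s ` Z \<subseteq> X"
    using Z(1) assms(2) unfolding bij_betw_def by auto
  have "infinite ?R"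
    using Z(3) assms(1) eqpoll_finite_iff by blast
  then obtain A B where AB: "A \<union> B = ?R" "A \<inter> B = {}" "A \<approx> ?R" "B \<approx> ?R"
    using infinite_split by blast
  then have eq: "A \<approx> X" "B \<approx> X"
    using Z(3) eqpoll_trans by blast+
  have injs: "inj_on s Z"
    using assms(2) Z(1) unfolding bij_betw_def by (meson inj_on_subset)
  \<comment> \<open>The reserve \<open>B\<close> lies in all four complements, which makes them
    full-sized.\<close>
  have c: "X - (s ` Z \<union> A) \<approx> X" "X - (Z \<union> A) \<approx> X" "X - A \<approx> X" "X - Z \<approx> X"
    by (rule eqpoll_between[OF _ _ eq(2)]; use AB in auto)+
  let ?f = "\<lambda>y. if y \<in> A then y else inv_into Z s y"
  have "bij_betw ?f (s ` Z) Z"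
    using bij_betw_inv_into[OF inj_on_imp_bij_betw[OF injs]]
    by (rule bij_betw_cong[THEN iffD1, rotated]) (use AB in auto)
  moreover have "bij_betw ?f A A"
    by (auto simp: bij_betw_def inj_on_def)
  ultimately have f: "bij_betw ?f (s ` Z \<union> A) (Z \<union> A)"
    by (rule bij_betw_combine) (use AB in auto)
  obtain g where g: "bij_betw g (X - (s ` Z \<union> A)) (X - (Z \<union> A))"
    using c eqpoll_sym eqpoll_trans unfolding eqpoll_def by (metis bij_betw_inv bij_betw_trans)
  obtain t where t: "bij_betw t X X" "\<And>y. y \<in> s ` Z \<union> A \<Longrightarrow> t y = ?f y"
    using bij_betw_glue[OF f g] AB Z sZ by (metis Diff_subset Un_least le_supE)
  have 1: "t \<in> pointwise_stabilizer X A"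
    using t by (simp add: pointwise_stabilizer_def)
  have "t (s z) = z" if "z \<in> Z" for z
  proof -
    have "s z \<notin> A"
      using that AB by auto
    then show ?thesis
      using t(2)[of "s z"] that injs by simp
  qed
  then have 2: "t \<circ> s \<in> pointwise_stabilizer X Z"
    using t(1) assms(2) bij_betw_trans by (auto simp: pointwise_stabilizer_def)
  have "moiety X A" "moiety X Z"
    using AB eq Z c by (auto simp: moiety_def)
  then show thesis
    using that 1 2 by blast
qed

lemma stabilizer_comp:
  "g \<in> pointwise_stabilizer X Y \<Longrightarrow> h \<in> pointwise_stabilizer X Y \<Longrightarrow> g \<circ> h \<in> pointwise_stabilizer X Y"
  by (auto simp: pointwise_stabilizer_def intro: bij_betw_trans)

lemma stabilizer_id: "id \<in> pointwise_stabilizer X Y"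
  by (simp add: pointwise_stabilizer_def)

lemma stabilizer_inv:
  assumes "g \<in> pointwise_stabilizer X Y" "Y \<subseteq> X"
  shows "inv_into X g \<in> pointwise_stabilizer X Y"
  using assms by (auto simp: pointwise_stabilizer_def bij_betw_inv_into)
    (metis bij_betw_inv_into_left subsetD)

section \<open>Calculus of the operations in \<open>C\<close>\<close>

locale symmetric_precomplete_clone =
  fixes X :: "'a set" and C :: "'a operation set"
  assumes infinite: "infinite X"
    and precomplete: "precomplete X C"
    and symmetric: "symmetric X C"
begin

text \<open>Allows arbitrary HOL functions to stand for operations, so that values outside
  \<open>X\<close> need not be normalized at each composition.\<close>

definition represents :: "nat \<Rightarrow> ('a list \<Rightarrow> 'a) \<Rightarrow> bool" where
  "represents n f \<longleftrightarrow> (n, restrict f (tuples X n)) \<in> C"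

lemma clone: "clone X C"
  using precomplete by (simp add: precomplete_def)

lemma member_ops:
  assumes "(n, f) \<in> C"
  shows "1 \<le> n" "f \<in> tuples X n \<rightarrow>\<^sub>E X"
proof -
  have "(n, f) \<in> ops X"
    using clone assms by (auto simp: clone_def)
  then show "1 \<le> n" "f \<in> tuples X n \<rightarrow>\<^sub>E X"
    by (auto simp: ops_def ops_of_arity_def)
qed

lemma represents_iff: "represents n f \<longleftrightarrow> (\<exists>g. (n, g) \<in> C \<and> (\<forall>xs\<in>tuples X n. g xs = f xs))"
proof
  assume "represents n f"
  then show "\<exists>g. (n, g) \<in> C \<and> (\<forall>xs\<in>tuples X n. g xs = f xs)"
    unfolding represents_def by (metis restrict_apply)
next
  assume "\<exists>g. (n, g) \<in> C \<and> (\<forall>xs\<in>tuples X n. g xs = f xs)"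
  then obtain g where g: "(n, g) \<in> C" "\<forall>xs\<in>tuples X n. g xs = f xs"
    by blast
  have "restrict f (tuples X n) = restrict g (tuples X n)"
    using g(2) by (simp cong: restrict_cong)
  also have "\<dots> = g"
    using member_ops(2)[OF g(1)] PiE_restrict by blast
  finally show "represents n f"
    using g(1) by (simp add: represents_def)
qed

lemma represents_restrict:
  assumes "(n, restrict g (tuples X n)) \<in> C" "\<And>xs. xs \<in> tuples X n \<Longrightarrow> g xs = f xs"
  shows "represents n f"
  unfolding represents_iff using assms by (intro exI[of _ "restrict g (tuples X n)"]) simp

lemma represents_closed: "represents n f \<Longrightarrow> xs \<in> tuples X n \<Longrightarrow> f xs \<in> X"
  unfolding represents_iff by (metis PiE_mem member_ops(2))

lemma represents_cong:
  assumes "represents n f" "\<And>xs. xs \<in> tuples X n \<Longrightarrow> g xs = f xs"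
  shows "represents n g"
  using assms unfolding represents_iff by fastforce

lemma represents_proj: "i < n \<Longrightarrow> represents n (\<lambda>xs. xs ! i)"
proof -
  assume "i < n"
  then have "projection X n (Suc i) \<in> C"
    using clone by (simp add: clone_def)
  then show ?thesis
    by (simp add: represents_def projection_def)
qed

lemma represents_compose:
  assumes f: "represents n f" and len: "length gs = n" and gs: "\<And>g. g \<in> set gs \<Longrightarrow> represents m g"
  shows "represents m (\<lambda>xs. f (map (\<lambda>g. g xs) gs))"
proof -
  let ?f = "restrict f (tuples X n)" and ?gs = "map (\<lambda>g. restrict g (tuples X m)) gs"
  have "(n, ?f) \<in> C" "length ?gs = n" "\<forall>g\<in>set ?gs. (m, g) \<in> C"
    using f len gs by (auto simp: represents_def)
  then have "compose_ops X m ?f ?gs \<in> C"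
    using clone unfolding clone_def by blast
  then show ?thesis
    unfolding compose_ops_def
  proof (rule represents_restrict)
    fix xs assume xs: "xs \<in> tuples X m"
    have "map (\<lambda>g. g xs) ?gs = map (\<lambda>g. g xs) gs"
      using xs by (simp add: comp_def)
    moreover have "map (\<lambda>g. g xs) gs \<in> tuples X n"
      using len represents_closed[OF gs xs] by (auto simp: tuples_def)
    ultimately show "?f (map (\<lambda>g. g xs) ?gs) = f (map (\<lambda>g. g xs) gs)"
      by (simp only: restrict_apply')
  qed
qed

lemma represents_conjugate:
  assumes f: "represents n f" and s: "bij_betw s X X"
  shows "represents n (\<lambda>xs. s (f (map (inv_into X s) xs)))"
proof -
  let ?s = "inv_into X s" and ?f = "restrict f (tuples X n)"
  have s': "bij_betw ?s X X"
    using s by (rule bij_betw_inv_into)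
  \<comment> \<open>\<open>conjugate_op\<close> puts the inverse of its parameter outside, so it is
    applied to the inverse of \<open>s\<close>.\<close>
  have "conjugate_op X ?s (n, ?f) \<in> C"
    using symmetric f s' unfolding symmetric_def represents_def by blast
  then have "(n, \<lambda>xs\<in>tuples X n. inv_into X ?s (?f (map ?s xs))) \<in> C"
    unfolding conjugate_op_def by simp
  then show ?thesis
  proof (rule represents_restrict)
    fix xs assume xs: "xs \<in> tuples X n"
    have t: "map ?s xs \<in> tuples X n"
      using xs bij_betwE[OF s'] by (auto simp: tuples_def)
    then have "f (map ?s xs) \<in> X"
      using f represents_closed by blast
    then have "inv_into X ?s (f (map ?s xs)) = s (f (map ?s xs))"
      using s by (simp add: inv_into_inv_into_eq)
    then show "inv_into X ?s (?f (map ?s xs)) = s (f (map ?s xs))"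
      using t by simp
  qed
qed

abbreviation unary :: "('a \<Rightarrow> 'a) \<Rightarrow> bool" where
  "unary u \<equiv> represents (Suc 0) (\<lambda>xs. u (hd xs))"

lemma tuples_1: "tuples Y (Suc 0) = (\<lambda>x. [x]) ` Y"
  by (auto simp: tuples_def length_Suc_conv image_iff)

lemma unary_closed: "unary u \<Longrightarrow> x \<in> X \<Longrightarrow> u x \<in> X"
  using represents_closed[of "Suc 0" "\<lambda>xs. u (hd xs)" "[x]"] by (simp add: tuples_1)

lemma unary_cong: "unary u \<Longrightarrow> (\<And>x. x \<in> X \<Longrightarrow> v x = u x) \<Longrightarrow> unary v"
  by (erule represents_cong) (auto simp: tuples_1)

lemma unary_compose:
  assumes "represents n f" "length us = n" "\<And>u. u \<in> set us \<Longrightarrow> unary u"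
  shows "unary (\<lambda>x. f (map (\<lambda>u. u x) us))"
proof -
  have "represents (Suc 0) (\<lambda>xs. f (map (\<lambda>g. g xs) (map (\<lambda>u xs. u (hd xs)) us)))"
    by (rule represents_compose[OF assms(1)]) (use assms in auto)
  then show ?thesis
    by (simp add: comp_def)
qed

lemma unary_o: "unary u \<Longrightarrow> unary v \<Longrightarrow> unary (u \<circ> v)"
  using unary_compose[of "Suc 0" "\<lambda>xs. u (hd xs)" "[v]"] by (simp add: comp_def)

lemma unary_conjugate: "unary u \<Longrightarrow> bij_betw s X X \<Longrightarrow> unary (s \<circ> u \<circ> inv_into X s)"
  by (drule (1) represents_conjugate, erule represents_cong) (auto simp: tuples_1)

lemma permutation_opsI:
  assumes "\<And>s. bij_betw s X X \<Longrightarrow> unary s"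
  shows "permutation_ops X \<subseteq> C"
  using assms by (auto simp: permutation_ops_def represents_def)

section \<open>The clone generated by \<open>C\<close> and a set of permutations\<close>

text \<open>
  For a composition-closed set \<open>H\<close> of permutations, these are the operations of the clone
  generated by \<open>C\<close> and \<open>H\<close>: since \<open>C\<close> is closed under conjugation, permutations can be
  moved past the operations of \<open>C\<close> down to the variables.
\<close>

inductive generated :: "('a \<Rightarrow> 'a) set \<Rightarrow> nat \<Rightarrow> ('a list \<Rightarrow> 'a) \<Rightarrow> bool"
  for H :: "('a \<Rightarrow> 'a) set" and n :: nat where
  variable: "s \<in> H \<Longrightarrow> i < n \<Longrightarrow> generated H n (\<lambda>xs. s (xs ! i))"
| compose: "represents m f \<Longrightarrow> length ts = m \<Longrightarrow> \<forall>t\<in>set ts. generated H n t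
    \<Longrightarrow> generated H n (\<lambda>xs. f (map (\<lambda>t. t xs) ts))"
| agree: "generated H n t \<Longrightarrow> \<forall>xs\<in>tuples X n. t' xs = t xs \<Longrightarrow> generated H n t'"

lemma generated_closed:
  assumes "generated H n t" "H \<subseteq> {s. bij_betw s X X}" "xs \<in> tuples X n"
  shows "t xs \<in> X"
  using assms(1)
proof induction
  case (variable s i)
  then have "xs ! i \<in> X"
    using assms(3) by (auto simp: tuples_def)
  then show ?case
    using variable assms(2) bij_betwE by blast
next
  case (compose m f ts)
  then have "map (\<lambda>t. t xs) ts \<in> tuples X m"
    by (auto simp: tuples_def)
  then show ?case
    using compose represents_closed by blast
next
  case (agree t t')
  then show ?case
    using assms(3) by simp
qed

text \<open>An outer \<open>s\<close> moves past \<open>f\<close> by replacing \<open>f\<close> with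
  its conjugate, which symmetry keeps in \<open>C\<close>, and applying \<open>s\<close> to each
  argument.\<close>

lemma generated_perm:
  assumes "generated H n t" "H \<subseteq> {s. bij_betw s X X}" "s \<in> H"
    and "\<And>s s'. s \<in> H \<Longrightarrow> s' \<in> H \<Longrightarrow> s \<circ> s' \<in> H"
  shows "generated H n (\<lambda>xs. s (t xs))"
  using assms(1)
proof induction
  case (variable s' i)
  have "s \<circ> s' \<in> H"
    using assms variable by blast
  from generated.variable[OF this variable(2)] show ?case
    by simp
next
  case (compose m f ts)
  have s: "bij_betw s X X"
    using assms by blast
  let ?f = "\<lambda>xs. s (f (map (inv_into X s) xs))" and ?ts = "map (\<lambda>t xs. s (t xs)) ts"
  have "generated H n (\<lambda>xs. ?f (map (\<lambda>t. t xs) ?ts))"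
    by (rule generated.compose[OF represents_conjugate[OF compose(1) s]]) (use compose in auto)
  then show ?case
  proof (rule generated.agree, intro ballI)
    fix xs assume xs: "xs \<in> tuples X n"
    \<comment> \<open>Cancelling \<open>s\<close> requires arguments in \<open>X\<close>, hence
      \<open>generated_closed\<close>.\<close>
    have "map (inv_into X s) (map (\<lambda>t. t xs) ?ts) = map (\<lambda>t. t xs) ts"
      using compose.IH generated_closed[OF _ assms(2) xs] s
      by (auto simp: bij_betw_inv_into_left compose(3))
    then show "s (f (map (\<lambda>t. t xs) ts)) = ?f (map (\<lambda>t. t xs) ?ts)"
      by (simp only:)
  qed
next
  case (agree t t')
  show ?case
    by (rule generated.agree[OF agree.IH]) (use agree in simp)
qed

text \<open>At a leaf the substituted operation appears under a permutation, which
  \<open>generated_perm\<close> absorbs.\<close>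

lemma generated_substitute:
  assumes "generated H n t" "H \<subseteq> {s. bij_betw s X X}"
    and "\<And>s s'. s \<in> H \<Longrightarrow> s' \<in> H \<Longrightarrow> s \<circ> s' \<in> H"
    and "length gs = n" "\<And>g. g \<in> set gs \<Longrightarrow> generated H m g"
  shows "generated H m (\<lambda>xs. t (map (\<lambda>g. g xs) gs))"
  using assms(1)
proof induction
  case (variable s i)
  have "generated H m (gs ! i)"
    using assms(4,5) variable by simp
  from generated_perm[OF this assms(2) variable(1) assms(3)] show ?case
    using assms(4) variable by simp
next
  case (compose k f ts)
  let ?ts = "map (\<lambda>t xs. t (map (\<lambda>g. g xs) gs)) ts"
  have "generated H m (\<lambda>xs. f (map (\<lambda>t. t xs) ?ts))"
    by (rule generated.compose[OF compose(1)]) (use compose in auto)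
  then show ?case
    by (simp add: comp_def)
next
  case (agree t t')
  show ?case
  proof (rule generated.agree[OF agree.IH], intro ballI)
    fix xs assume "xs \<in> tuples X m"
    then have "map (\<lambda>g. g xs) gs \<in> tuples X n"
      using assms(4,5) generated_closed[OF _ assms(2)] by (auto simp: tuples_def)
    then show "t' (map (\<lambda>g. g xs) gs) = t (map (\<lambda>g. g xs) gs)"
      using agree by blast
  qed
qed

text \<open>The generated operations form a clone containing \<open>C\<close> and also
  \<open>s\<close>, which is not in \<open>C\<close>; precompleteness makes it everything.\<close>

lemma generated_all:
  assumes H: "H \<subseteq> {s. bij_betw s X X}" "id \<in> H" "\<And>s s'. s \<in> H \<Longrightarrow> s' \<in> H \<Longrightarrow> s \<circ> s' \<in> H"
    and s: "s \<in> H" "\<not> unary s"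
    and h: "1 \<le> n" "\<And>xs. xs \<in> tuples X n \<Longrightarrow> h xs \<in> X"
  shows "generated H n h"
proof -
  let ?D = "{(n, f) \<in> ops X. generated H n f}"
  have proj: "generated H n (\<lambda>xs. xs ! i)" if "i < n" for n i
    using generated.variable[OF H(2) that] by simp
  have op: "(n, restrict t (tuples X n)) \<in> ?D" if "generated H n t" "1 \<le> n" for n t
    using that generated.agree[OF that(1), of "restrict t (tuples X n)"] generated_closed[OF that(1) H(1)]
    by (auto simp: ops_def ops_of_arity_def)
  have "clone X ?D"
    unfolding clone_def
  proof (intro conjI allI impI)
    fix n k :: nat assume "1 \<le> k \<and> k \<le> n"
    then show "projection X n k \<in> ?D"
      unfolding projection_def by (intro op proj) auto
  next
    fix n m f gs assume a: "(n, f) \<in> ?D \<and> length gs = n \<and> (\<forall>g\<in>set gs. (m, g) \<in> ?D)"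
    then have "1 \<le> n"
      by (auto simp: ops_def ops_of_arity_def)
    \<comment> \<open>Positive arity of \<open>f\<close> makes \<open>gs\<close> nonempty, and its
      members force \<open>m\<close> to be positive.\<close>
    then obtain g where "g \<in> set gs"
      using a by (cases gs) auto
    then have "1 \<le> m"
      using a by (auto simp: ops_def ops_of_arity_def)
    then show "compose_ops X m f gs \<in> ?D"
      unfolding compose_ops_def using a
      by (intro op generated_substitute[OF _ H(1) H(3), of n]) auto
  qed auto
  moreover have "C \<subset> ?D"
  proof
    show "C \<subseteq> ?D"
    proof clarify
      fix n f assume f: "(n, f) \<in> C"
      then have "represents n f"
        unfolding represents_iff by blast
      then have "generated H n (\<lambda>xs. f (map (\<lambda>t. t xs) (map (\<lambda>i xs. xs ! i) [0..<n])))"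
        by (rule generated.compose) (auto simp: proj)
      then have "generated H n f"
        by (rule generated.agree) (auto simp: tuples_def comp_def map_nth)
      then show "(n, f) \<in> ops X \<and> generated H n f"
        using f clone by (auto simp: clone_def)
    qed
    have "generated H (Suc 0) (\<lambda>xs. s (xs ! 0))"
      by (rule generated.variable[OF s(1)]) simp
    then have "generated H (Suc 0) (\<lambda>xs. s (hd xs))"
      by (rule generated.agree) (auto simp: tuples_1)
    from op[OF this] show "C \<noteq> ?D"
      using s(2) unfolding represents_def by auto
  qed
  ultimately have "?D = ops X"
    using precomplete unfolding precomplete_def by blast
  moreover have "(n, restrict h (tuples X n)) \<in> ops X"
    using h by (auto simp: ops_def ops_of_arity_def)
  ultimately have "generated H n (restrict h (tuples X n))"
    by blast
  then show ?thesis
    by (rule generated.agree) simp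
qed

section \<open>Interpolation on sets with large complement\<close>

text \<open>If one such stabilizer lay in \<open>C\<close>, conjugation would put all of them there,
  and the factorization every permutation.\<close>

lemma ex_nonmember_stabilizer:
  assumes "\<not> permutation_ops X \<subseteq> C" "moiety X Y"
  shows "\<exists>s \<in> pointwise_stabilizer X Y. \<not> unary s"
proof (rule ccontr)
  assume "\<not> ?thesis"
  then have Y: "unary s" if "s \<in> pointwise_stabilizer X Y" for s
    using that by blast
  have all: "unary s" if Z: "moiety X Z" and s: "s \<in> pointwise_stabilizer X Z" for Z s
  proof -
    obtain d where d: "bij_betw d X X" "d ` Y = Z"
      using moiety_bij[OF assms(2) Z] by blast
    have YX: "Y \<subseteq> X"
      using assms(2) by (simp add: moiety_def)
    have sX: "bij_betw s X X"
      using s by (simp add: pointwise_stabilizer_def)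
    have "bij_betw (inv_into X d \<circ> s \<circ> d) X X"
      using d(1) sX bij_betw_inv_into[OF d(1)] by (intro bij_betw_trans[of _ X X]) auto
    then have "inv_into X d \<circ> s \<circ> d \<in> pointwise_stabilizer X Y"
      using d s YX by (auto simp: pointwise_stabilizer_def bij_betw_inv_into_left)
    then have "unary (d \<circ> (inv_into X d \<circ> s \<circ> d) \<circ> inv_into X d)"
      using Y d(1) unary_conjugate by blast
    then show ?thesis
      by (rule unary_cong) (use bij_betw_inv_into_right[OF d(1)] bij_betwE[OF sX] in simp)
  qed
  have "unary s" if s: "bij_betw s X X" for s
  proof -
    obtain Y t Z where t: "moiety X Y" "moiety X Z" "t \<in> pointwise_stabilizer X Y"
      "t \<circ> s \<in> pointwise_stabilizer X Z"
      using permutation_factorization[OF infinite s] by blast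
    have "inv_into X t \<in> pointwise_stabilizer X Y"
      using t(1,3) stabilizer_inv by (auto simp: moiety_def)
    then have "unary (inv_into X t \<circ> (t \<circ> s))"
      by (intro unary_o all[OF t(1)] all[OF t(2) t(4)])
    then show ?thesis
      using t(3) bij_betwE[OF s]
      by (elim unary_cong) (auto simp: pointwise_stabilizer_def bij_betw_inv_into_left)
  qed
  then show False
    using permutation_opsI assms(1) by blast
qed

lemma generated_stabilizer:
  assumes "\<not> permutation_ops X \<subseteq> C" "moiety X Y"
    and "1 \<le> n" "h \<in> tuples X n \<rightarrow> X"
  shows "generated (pointwise_stabilizer X Y) n h"
proof -
  obtain s where s: "s \<in> pointwise_stabilizer X Y" "\<not> unary s"
    using ex_nonmember_stabilizer[OF assms(1,2)] by blast
  have "pointwise_stabilizer X Y \<subseteq> {s. bij_betw s X X}"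
    by (auto simp: pointwise_stabilizer_def)
  then show ?thesis
    by (rule generated_all[OF _ stabilizer_id stabilizer_comp s assms(3)]) (use assms(4) in auto)
qed

text \<open>Enlarge \<open>Y\<close> to a moiety \<open>Z\<close> and write \<open>h\<close> over
  the stabilizer of \<open>Z\<close>. Its permutations occur only at the variables and act trivially
  on \<open>Y\<close>, so erasing them leaves an operation of \<open>C\<close> with the same values
  there.\<close>

lemma interpolation:
  assumes "\<not> permutation_ops X \<subseteq> C" "Y \<subseteq> X" "X - Y \<approx> X"
    and "1 \<le> n" "h \<in> tuples X n \<rightarrow> X"
  obtains g where "represents n g" "\<And>xs. xs \<in> tuples Y n \<Longrightarrow> g xs = h xs"
proof -
  obtain Z where Z: "moiety X Z" "Y \<subseteq> Z"
    using colarge_subset_moiety[OF infinite assms(2,3)] by blast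
  have "generated (pointwise_stabilizer X Z) n h"
    by (rule generated_stabilizer[OF assms(1) Z(1) assms(4,5)])
  then have "\<exists>g. represents n g \<and> (\<forall>xs\<in>tuples Y n. g xs = h xs)"
  proof induction
    case (variable s i)
    have "s (xs ! i) = xs ! i" if "xs \<in> tuples Y n" for xs
    proof -
      have "xs ! i \<in> Z"
        using that variable(2) Z(2) nth_mem by (fastforce simp: tuples_def)
      then show ?thesis
        using variable(1) by (simp add: pointwise_stabilizer_def)
    qed
    then show ?case
      using represents_proj[OF variable(2)] by force
  next
    case (compose m f ts)
    then have "\<forall>t\<in>set ts. \<exists>g. represents n g \<and> (\<forall>xs\<in>tuples Y n. g xs = t xs)"
      by blast
    then obtain G where G: "\<And>t. t \<in> set ts \<Longrightarrow> represents n (G t)"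
        "\<And>t xs. t \<in> set ts \<Longrightarrow> xs \<in> tuples Y n \<Longrightarrow> G t xs = t xs"
      by metis
    have "represents n (\<lambda>xs. f (map (\<lambda>g. g xs) (map G ts)))"
      by (rule represents_compose[OF compose(1)]) (use compose G in auto)
    moreover have "map (\<lambda>g. g xs) (map G ts) = map (\<lambda>t. t xs) ts" if "xs \<in> tuples Y n" for xs
      using G(2) that by simp
    ultimately show ?case
      by metis
  next
    case (agree t t')
    moreover have "tuples Y n \<subseteq> tuples X n"
      using assms(2) by (auto simp: tuples_def)
    ultimately show ?case
      by (metis subsetD)
  qed
  then show thesis
    using that by blast
qed

lemma unary_interpolation:
  assumes "\<not> permutation_ops X \<subseteq> C" "Y \<subseteq> X" "X - Y \<approx> X" "h \<in> X \<rightarrow> X"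
  obtains u where "unary u" "\<And>x. x \<in> Y \<Longrightarrow> u x = h x"
proof -
  obtain g where g: "represents (Suc 0) g" "\<And>xs. xs \<in> tuples Y (Suc 0) \<Longrightarrow> g xs = h (hd xs)"
    by (rule interpolation[OF assms(1-3), of "Suc 0" "\<lambda>xs. h (hd xs)"]) (use assms(4) in \<open>auto simp: tuples_1\<close>)
  have "unary (\<lambda>x. g [x])"
    by (rule represents_cong[OF g(1)]) (auto simp: tuples_1)
  then show thesis
    using that g(2) by (auto simp: tuples_def)
qed

section \<open>Retractions in \<open>C\<close> and the majority argument\<close>

text \<open>Write \<open>b\<close> over the permutations moving only points of \<open>Y\<close>. At
  a leaf, \<open>s \<circ> u\<close> equals the conjugate of \<open>u\<close> by \<open>s\<close>;
  compositions with operations of \<open>C\<close> follow by induction.\<close>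

lemma unary_left_ideal:
  assumes "\<not> permutation_ops X \<subseteq> C" "moiety X Y"
    and u: "unary u" "\<And>x. x \<in> Y \<Longrightarrow> u x = a"
    and b: "\<And>x. x \<in> X \<Longrightarrow> b x \<in> X"
  shows "unary (b \<circ> u)"
proof -
  have YX: "Y \<subseteq> X"
    using assms(2) by (simp add: moiety_def)
  then have "X - (X - Y) = Y"
    by blast
  then have "moiety X (X - Y)"
    using assms(2) by (simp add: moiety_def)
  then have "generated (pointwise_stabilizer X (X - Y)) (Suc 0) (\<lambda>xs. b (hd xs))"
    by (rule generated_stabilizer[OF assms(1)]) (use b in \<open>auto simp: tuples_1\<close>)
  then have "unary (\<lambda>x. (\<lambda>xs. b (hd xs)) [u x])"
  proof induction
    case (variable s i)
    have s: "bij_betw s X X" "\<And>x. x \<in> X - Y \<Longrightarrow> s x = x"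
      using variable by (auto simp: pointwise_stabilizer_def)
    \<comment> \<open>\<open>s\<close> fixes the complement of \<open>Y\<close> pointwise, so it
      preserves \<open>Y\<close>, where \<open>u\<close> is constant.\<close>
    have "u (inv_into X s x) = u x" if "x \<in> X" for x
    proof (cases "x \<in> Y")
      case True
      have "inv_into X s x \<in> X" "s (inv_into X s x) = x"
        using that s(1) by (simp_all add: bij_betw_inv_into_right bij_betwE[OF bij_betw_inv_into])
      then have "inv_into X s x \<in> Y"
        using s(2) True by (metis DiffI)
      then show ?thesis
        using u(2) True by simp
    next
      case False
      then have "inv_into X s x = x"
        using s that by (metis DiffI bij_betw_inv_into_left)
      then show ?thesis
        by simp
    qed
    then show ?case
      using variable(2) by (intro unary_cong[OF unary_conjugate[OF u(1) s(1)]]) simp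
  next
    case (compose m f ts)
    have "unary (\<lambda>x. f (map (\<lambda>v. v x) (map (\<lambda>t x. t [u x]) ts)))"
      by (rule unary_compose[OF compose(1)]) (use compose in auto)
    then show ?case
      by (simp add: comp_def)
  next
    case (agree t t')
    then show ?case
      using unary_closed[OF u(1)] by (elim conjE unary_cong) (auto simp: tuples_1)
  qed
  then show ?thesis
    by (simp add: comp_def)
qed

lemma contains_permutations: "permutation_ops X \<subseteq> C"
proof (rule ccontr)
  assume neg: "\<not> permutation_ops X \<subseteq> C"
  obtain Y1 Z where Z: "Y1 \<union> Z = X" "Y1 \<inter> Z = {}" "Y1 \<approx> X" "Z \<approx> X"
    by (rule infinite_split[OF infinite])
  have "infinite Z"
    using Z(4) infinite eqpoll_finite_iff by blast
  then obtain Y2 Y3 where Y: "Y2 \<union> Y3 = Z" "Y2 \<inter> Y3 = {}" "Y2 \<approx> Z" "Y3 \<approx> Z"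
    by (rule infinite_split)
  then have eq: "Y2 \<approx> X" "Y3 \<approx> X"
    using Z(4) eqpoll_trans by blast+
  have X: "X = Y1 \<union> Y2 \<union> Y3"
    using Y Z by blast
  have sub: "Y1 \<subseteq> X" "Y2 \<subseteq> X" "Y3 \<subseteq> X"
    unfolding X by auto
  have disj: "Y1 \<inter> Y2 = {}" "Y1 \<inter> Y3 = {}" "Y2 \<inter> Y3 = {}"
    using Y Z by blast+
  obtain e where e: "bij_betw e X Y2"
    using eq(1) eqpoll_sym unfolding eqpoll_def by blast
  have eX: "e x \<in> Y2" if "x \<in> X" for x
    using e that bij_betwE by blast
  have "Y1 \<noteq> {}"
    using infinite Z(3) eqpoll_finite_iff by blast
  then obtain a where a: "a \<in> Y1"
    by blast
  have "X - Y1 \<approx> X"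
    by (rule eqpoll_between[OF _ _ eq(1)]) (use X disj in auto)
  then have Y1: "moiety X Y1"
    using X Z(3) by (auto simp: moiety_def)
  have "X - (Y1 \<union> Y2) = Y3"
    using X disj by blast
  then have co: "X - (Y1 \<union> Y2) \<approx> X"
    using eq(2) by simp
  \<comment> \<open>Only the values on \<open>Y1\<close> and \<open>Y2\<close> matter: interpolation
    leaves \<open>u\<close> uncontrolled on \<open>Y3\<close>.\<close>
  define p where "p x = (if x \<in> Y1 then a else x)" for x
  have p: "Y1 \<union> Y2 \<subseteq> X" "p \<in> X \<rightarrow> X"
    using sub a by (auto simp: p_def)
  obtain u where "unary u" "\<And>x. x \<in> Y1 \<union> Y2 \<Longrightarrow> u x = p x"
    by (rule unary_interpolation[OF neg p(1) co p(2)]) (rule that)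
  then have u: "unary u" "\<And>x. x \<in> Y1 \<union> Y2 \<Longrightarrow> u x = (if x \<in> Y1 then a else x)"
    by (simp_all add: p_def)
  \<comment> \<open>The outer map pushes every value outside \<open>Y2\<close> into
    \<open>Y2\<close>, including the uncontrolled ones, and \<open>v\<close> becomes a retraction
    onto \<open>Y2\<close>.\<close>
  define v where "v = (\<lambda>x. if x \<in> Y2 then x else e x) \<circ> u"
  have v: "unary v"
    unfolding v_def
    by (rule unary_left_ideal[OF neg Y1 u(1), of a]) (use u(2) X eX in auto)
  have vY: "v x \<in> Y2" if "x \<in> X" for x
    using unary_closed[OF u(1) that] eX by (auto simp: v_def)
  have vid: "v x = x" if "x \<in> Y2" for x
    using u(2)[of x] that disj by (auto simp: v_def)
  have coord: "\<exists>w. unary w \<and> (\<forall>x\<in>X. w x \<in> Y2) \<and> (\<forall>x\<in>X - Y. w x = e x)"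
    if Y: "Y \<subseteq> X" "Y \<approx> X" for Y
  proof -
    \<comment> \<open>The set to interpolate on is \<open>X - Y\<close>, whose complement
      \<open>Y\<close> is large. Then \<open>v\<close> forces values into \<open>Y2\<close> without
      disturbing those of \<open>e\<close>.\<close>
    have co: "X - (X - Y) \<approx> X"
      using Y by (simp add: double_diff)
    have eXX: "e \<in> X \<rightarrow> X"
      using eX sub(2) by blast
    obtain f where f: "unary f" "\<And>x. x \<in> X - Y \<Longrightarrow> f x = e x"
      by (rule unary_interpolation[OF neg Diff_subset co eXX]) (rule that)
    have "unary (v \<circ> f)"
      using v f(1) by (rule unary_o)
    moreover have "\<forall>x\<in>X. (v \<circ> f) x \<in> Y2"
      using vY unary_closed[OF f(1)] by simp
    moreover have "\<forall>x\<in>X - Y. (v \<circ> f) x = e x"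
      using f(2) vid eX by simp
    ultimately show ?thesis
      by blast
  qed
  obtain w1 w2 w3 where w: "unary w1" "unary w2" "unary w3"
    and wY: "\<forall>x\<in>X. w1 x \<in> Y2" "\<forall>x\<in>X. w2 x \<in> Y2" "\<forall>x\<in>X. w3 x \<in> Y2"
    and we: "\<forall>x\<in>X - Y1. w1 x = e x" "\<forall>x\<in>X - Y2. w2 x = e x" "\<forall>x\<in>X - Y3. w3 x = e x"
    using coord[OF sub(1) Z(3)] coord[OF sub(2) eq(1)] coord[OF sub(3) eq(2)] by blast
  have "unary s" if s: "bij_betw s X X" for s
  proof -
    \<comment> \<open>If the first two entries differ while two of the three equal
      \<open>e x\<close>, the third must be \<open>e x\<close>.\<close>
    define majority where "majority xs = (if xs ! 0 = xs ! 1 then xs ! 0 else xs ! 2)" for xs :: "'a list"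
    \<comment> \<open>The default \<open>a\<close> keeps \<open>?h\<close> inside \<open>X\<close>
      on all triples; only triples over \<open>Y2\<close> are evaluated later.\<close>
    let ?h = "\<lambda>xs. if majority xs \<in> Y2 then s (inv_into X e (majority xs)) else a"
    have "inv_into X e y \<in> X" if "y \<in> Y2" for y
      using bij_betw_inv_into[OF e] that bij_betwE by blast
    then have hX: "?h \<in> tuples X 3 \<rightarrow> X"
      using bij_betwE[OF s] a X by auto
    have co: "X - Y2 \<approx> X"
      by (rule eqpoll_between[OF _ _ eq(2)]) (use X disj in auto)
    obtain g where g: "represents 3 g" "\<And>xs. xs \<in> tuples Y2 3 \<Longrightarrow> g xs = ?h xs"
      by (rule interpolation[OF neg sub(2) co _ hX]) (simp, rule that)
    have "unary (\<lambda>x. g (map (\<lambda>u. u x) [w1, w2, w3]))"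
      by (rule unary_compose[OF g(1)]) (use w in auto)
    then show ?thesis
    proof (rule unary_cong)
      fix x assume x: "x \<in> X"
      \<comment> \<open>Each point lies in at most one of the three sets, so at most one of the
        \<open>w\<close> values is wrong.\<close>
      have "x \<notin> Y1 \<and> x \<notin> Y2 \<or> x \<notin> Y1 \<and> x \<notin> Y3 \<or> x \<notin> Y2 \<and> x \<notin> Y3"
        using disj by blast
      then have pair: "w1 x = e x \<and> w2 x = e x \<or> w1 x = e x \<and> w3 x = e x \<or> w2 x = e x \<and> w3 x = e x"
        using we x by blast
      have "majority [w1 x, w2 x, w3 x] = e x"
        using pair by (auto simp: majority_def)
      then have "?h [w1 x, w2 x, w3 x] = s x"
        using eX[OF x] x e by (simp add: bij_betw_inv_into_left)
      moreover have "[w1 x, w2 x, w3 x] \<in> tuples Y2 3"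
        using wY x by (simp add: tuples_def)
      ultimately show "s x = g (map (\<lambda>u. u x) [w1, w2, w3])"
        using g(2) by simp
    qed
  qed
  then show False
    using neg permutation_opsI by blast
qed

end

theorem theorem3:
  fixes X :: "'a set" and C :: "'a operation set"
  assumes "infinite X"
    and "precomplete X C"
    and "symmetric X C"
  shows "permutation_ops X \<subseteq> C"
  using assms by (intro symmetric_precomplete_clone.contains_permutations symmetric_precomplete_clone.intro)

end
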